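(* Let $M,N:\mathbb{R}_+^2\to\mathbb{R}$ be two symmetric, homogeneous means and let $m,n:(0,1)\to\mathbb{R}$ be their respective Seiffert functions. If the function $m-n$ is decreasing on $(0,1)$, then for all $0<x,y\leq 1/2$ the inequality $$\frac{1}{M(x,y)}-\frac{1}{M(1-x,1-y)}\leq \frac{1}{N(x,y)}-\frac{1}{N(1-x,1-y)}$$ holds.
   Context: Here $\mathbb{R}_+=(0,\infty)$. A function $M:\mathbb{R}_+^2\to\mathbb{R}$ is called a mean if $\min(x,y)\leq M(x,y)\leq\max(x,y)$ for all $x,y>0$. It is symmetric if $M(x,y)=M(y,x)$ for all $x,y>0$, and homogeneous if $M(\lambda x,\lambda y)=\lambda M(x,y)$ for all $\lambda,x,y>0$. A Seiffert function is a function $m:(0,1)\to\mathbb{R}$ satisfying $\frac{z}{1+z}\leq m(z)\leq\frac{z}{1-z}$ for all $z\in(0,1)$. The Seiffert function of a symmetric, homogeneous mean $M$ is $m(z)=\frac{z}{M(1+z,1-z)}$ for $z\in(0,1)$. Equivalently, it is the unique Seiffert function $m$ such that $M(x,y)=\frac{|x-y|}{2m\left(\frac{|x-y|}{x+y}\right)}$ for all $x,y>0$ with $x\neq y$ (while $M(x,x)=x$). This formula establishes a one-to-one correspondence between symmetric, homogeneous means and Seiffert functions. *)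

theory Defs
  imports Complex_Main
begin

text \<open>
  Functions on the open quadrant of pairs of positive reals are represented as curried
  total functions on the reals; every condition is restricted to positive arguments, so
  the values elsewhere are irrelevant.
\<close>

definition is_mean :: "(real \<Rightarrow> real \<Rightarrow> real) \<Rightarrow> bool" where
  "is_mean M \<longleftrightarrow> (\<forall>x>0. \<forall>y>0. min x y \<le> M x y \<and> M x y \<le> max x y)"

definition symmetric_mean :: "(real \<Rightarrow> real \<Rightarrow> real) \<Rightarrow> bool" where
  "symmetric_mean M \<longleftrightarrow> is_mean M \<and> (\<forall>x>0. \<forall>y>0. M x y = M y x)"

definition homogeneous_mean :: "(real \<Rightarrow> real \<Rightarrow> real) \<Rightarrow> bool" where
  "homogeneous_mean M \<longleftrightarrow>
     is_mean M \<and> (\<forall>c>0. \<forall>x>0. \<forall>y>0. M (c * x) (c * y) = c * M x y)"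

text \<open>
  \<open>m\<close> is the Seiffert function of \<open>M\<close>. Only the values of \<open>m\<close> on the open unit interval
  matter. For a mean \<open>M\<close> the denominator lies between \<open>1 - z\<close> and \<open>1 + z\<close>, so it is positive
  and the bounds \<open>z / (1 + z) \<le> m z \<le> z / (1 - z)\<close> required of a Seiffert function hold.
\<close>
definition seiffert_function_of ::
    "(real \<Rightarrow> real \<Rightarrow> real) \<Rightarrow> (real \<Rightarrow> real) \<Rightarrow> bool" where
  "seiffert_function_of M m \<longleftrightarrow> (\<forall>z\<in>{0<..<1}. m z = z / M (1 + z) (1 - z))"

end

theory Submission
  imports Defs
begin

text \<open>
  For \<open>y < x\<close> the Seiffert correspondence gives \<open>1 / M x y = 2 * m z / (x - y)\<close> with
  \<open>z = (x - y) / (x + y)\<close>. The pairs \<open>(x, y)\<close> and \<open>(1 - x, 1 - y)\<close> have the same distance, so the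
  claim compares the values of \<open>m - n\<close> at \<open>\<bar>x - y\<bar> / (x + y)\<close> and \<open>\<bar>x - y\<bar> / (2 - x - y)\<close>,
  and the former argument is the larger one because \<open>x + y \<le> 1\<close>.
\<close>

lemma mean_diagonal:
  assumes "is_mean M" "x > 0"
  shows "M x x = x"
  using assms unfolding is_mean_def by force

text \<open>Scaling by the half-sum \<open>s\<close> suffices: \<open>s * z\<close> is the
  half-difference, so (x, y) is \<open>s\<close> times (1 + z, 1 - z), and homogeneity pulls
  \<open>s\<close> out.\<close>

lemma inverse_mean_eq_seiffert:
  assumes "homogeneous_mean M" "seiffert_function_of M m" "0 < y" "y < x"
  shows "1 / M x y = 2 * m ((x - y) / (x + y)) / (x - y)"
proof -
  define s z where "s = (x + y) / 2" and "z = (x - y) / (x + y)"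
  have s: "s > 0" and z: "0 < z" "z < 1"
    using assms by (simp_all add: s_def z_def)
  have "z * (x + y) = x - y"
    using assms by (simp add: z_def)
  then have sz: "s * z = (x - y) / 2"
    by (simp add: s_def mult.commute)
  have "s * (1 + z) = x" "s * (1 - z) = y"
    using sz by (simp_all add: distrib_left right_diff_distrib s_def field_simps)
  moreover have "M (s * (1 + z)) (s * (1 - z)) = s * M (1 + z) (1 - z)"
    using assms(1) s z unfolding homogeneous_mean_def by simp
  ultimately have "M x y = s * M (1 + z) (1 - z)"
    by simp
  moreover have "m z = z / M (1 + z) (1 - z)"
    using assms(2) z unfolding seiffert_function_of_def by simp
  \<comment> \<open>Cancelling \<open>z\<close> on the right leaves
    \<open>1 / (s * M (1 + z) (1 - z))\<close>; since division by 0 yields 0, this is valid for any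
    value of the mean.\<close>
  ultimately have "1 / M x y = m z / (s * z)"
    using z by simp
  then show ?thesis
    unfolding sz by (simp add: z_def)
qed

lemma inverse_mean_difference_le:
  assumes "symmetric_mean M" "homogeneous_mean M" "symmetric_mean N" "homogeneous_mean N"
    and "seiffert_function_of M m" "seiffert_function_of N n"
    and "antimono_on {0<..<1} (\<lambda>z. m z - n z)"
    and "0 < y" "y < x" "x \<le> 1 / 2"
  shows "1 / M x y - 1 / M (1 - x) (1 - y) \<le> 1 / N x y - 1 / N (1 - x) (1 - y)"
proof -
  define d z w where "d = x - y" and "z = d / (x + y)" and "w = d / (2 - x - y)"
  have d: "d > 0"
    using assms by (simp add: d_def)
  have "w \<le> z"
    unfolding w_def z_def using assms d by (intro divide_left_mono) auto
  moreover have "z \<in> {0<..<1}" "w \<in> {0<..<1}"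
    using assms d by (auto simp: z_def w_def d_def)
  ultimately have "m z - n z \<le> m w - n w"
    using assms(7) by (auto simp: monotone_on_def)
  \<comment> \<open>The factor 2 / d turns Seiffert values into reciprocals of means:
    \<open>z\<close> belongs to (x, y) and \<open>w\<close> to (1 - x, 1 - y).\<close>
  then have "2 * (m z - n z) / d \<le> 2 * (m w - n w) / d"
    using d by (intro divide_right_mono) auto
  then have "2 * m z / d - 2 * n z / d \<le> 2 * m w / d - 2 * n w / d"
    by (simp add: right_diff_distrib diff_divide_distrib)
  moreover have "1 / K x y = 2 * k z / d \<and> 1 / K (1 - x) (1 - y) = 2 * k w / d"
    if K: "symmetric_mean K" "homogeneous_mean K" "seiffert_function_of K k" for K k
  proof -
    \<comment> \<open>Reflection reverses the order, so the arguments are swapped to put the larger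
      entry, 1 - y, first.\<close>
    have "K (1 - x) (1 - y) = K (1 - y) (1 - x)"
      using K(1) assms unfolding symmetric_mean_def by simp
    then show ?thesis
      using inverse_mean_eq_seiffert[OF K(2,3), of y x]
        inverse_mean_eq_seiffert[OF K(2,3), of "1 - x" "1 - y"] assms
      by (simp add: d_def z_def w_def algebra_simps)
  qed
  from this[OF assms(1,2,5)] this[OF assms(3,4,6)]
  have "1 / M x y = 2 * m z / d" "1 / M (1 - x) (1 - y) = 2 * m w / d"
    "1 / N x y = 2 * n z / d" "1 / N (1 - x) (1 - y) = 2 * n w / d"
    by blast+
  ultimately show ?thesis
    by linarith
qed

theorem theorem4p1:
  fixes M N :: "real \<Rightarrow> real \<Rightarrow> real" and m n :: "real \<Rightarrow> real"
  assumes "symmetric_mean M" and "homogeneous_mean M"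
    and "symmetric_mean N" and "homogeneous_mean N"
    and "seiffert_function_of M m" and "seiffert_function_of N n"
    and "antimono_on {0<..<1} (\<lambda>z. m z - n z)"
  shows "\<forall>x y. 0 < x \<and> x \<le> 1 / 2 \<and> 0 < y \<and> y \<le> 1 / 2 \<longrightarrow>
    1 / M x y - 1 / M (1 - x) (1 - y) \<le> 1 / N x y - 1 / N (1 - x) (1 - y)"
proof (intro allI impI)
  fix x y :: real
  assume xy: "0 < x \<and> x \<le> 1 / 2 \<and> 0 < y \<and> y \<le> 1 / 2"
  consider "x = y" | "y < x" | "x < y"
    by linarith
  then show "1 / M x y - 1 / M (1 - x) (1 - y) \<le> 1 / N x y - 1 / N (1 - x) (1 - y)"
  proof cases
    case 1
    \<comment> \<open>On the diagonal \<open>z\<close> would be 0, outside the domain of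
      \<open>m\<close> and \<open>n\<close>; here both sides equal 1 / x - 1 / (1 - x).\<close>
    have "is_mean M" "is_mean N"
      using assms unfolding symmetric_mean_def by auto
    then show ?thesis
      using 1 xy by (simp add: mean_diagonal)
  next
    case 2
    then show ?thesis
      using inverse_mean_difference_le[OF assms] xy by blast
  next
    case 3
    \<comment> \<open>Symmetry reduces this case to the previous one with x and y exchanged.\<close>
    have "M x y = M y x" "M (1 - x) (1 - y) = M (1 - y) (1 - x)"
      "N x y = N y x" "N (1 - x) (1 - y) = N (1 - y) (1 - x)"
      using assms(1,3) xy unfolding symmetric_mean_def by auto
    then show ?thesis
      using inverse_mean_difference_le[OF assms, of x y] 3 xy by simp
  qed
qed

end
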